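(* Let $2\le m\le n$ and let $\mathbf a_1,\dots,\mathbf a_m\in\mathbb R^n$ be non-zero-variance vectors with standardized vectors $\mathbf a_1',\dots,\mathbf a_m'$. Then the unsigned incorrelation coefficient $\omega_{\mathbf a_1\mathbf a_2\cdots\mathbf a_m}$ is equal to the $m$-dimensional volume of the parallelotope $\{\sum_{i=1}^m t_i\mathbf a_i' : 0\le t_i\le 1\}$ formed by the vectors $\mathbf a_1',\dots,\mathbf a_m'$.
   Context: For $\mathbf a=(a_1,\dots,a_n)^T\in\mathbb R^n$ let $\mu_{\mathbf a}=\frac1n\sum_{i=1}^n a_i$ and let $\mathbf 1$ be the all-ones vector; $\mathbf a$ is a non-zero-variance vector if $\mathbf a-\mu_{\mathbf a}\mathbf 1\neq 0$. In that case its standardized vector is $\mathbf a'=\frac{\mathbf a-\mu_{\mathbf a}\mathbf 1}{\|\mathbf a-\mu_{\mathbf a}\mathbf 1\|}$ (Euclidean norm). For non-zero-variance vectors $\mathbf a_1,\dots,\mathbf a_m\in\mathbb R^n$ ($2\le m\le n$) with standardized vectors $\mathbf a_i'=(a'_{i1},\dots,a'_{in})^T$, and for $1\le j_1<\cdots<j_m\le n$, let $[\mathbf a'(m)\,|\,j_1,\dots,j_m]$ be the $m\times m$ matrix with $(i,k)$ entry $a'_{i j_k}$. The unsigned incorrelation coefficient $\omega_{\mathbf a_1\cdots\mathbf a_m}\ge0$ is the nonnegative number defined by $$\omega_{\mathbf a_1\cdots\mathbf a_m}^2=\sum_{1\le j_1<\cdots<j_m\le n}\bigl(\det[\mathbf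 a'(m)\,|\,j_1,\dots,j_m]\bigr)^2 .$$ The $m$-dimensional volume is the usual Euclidean one ($m$-dimensional Lebesgue measure on an $m$-dimensional subspace of $\mathbb R^n$ containing the parallelotope; it is $0$ if the vectors are linearly dependent). *)

theory Defs
  imports "HOL-Analysis.Analysis"
begin

definition vec_mean :: "real^'n \<Rightarrow> real" where
  "vec_mean a = (\<Sum>i\<in>UNIV. a $ i) / real CARD('n)"

definition centered :: "real^'n \<Rightarrow> real^'n" where
  "centered a = a - vec_mean a *\<^sub>R 1"

definition nonzero_variance :: "real^'n \<Rightarrow> bool" where
  "nonzero_variance a \<longleftrightarrow> centered a \<noteq> 0"

definition standardized :: "real^'n \<Rightarrow> real^'n" where
  "standardized a = centered a /\<^sub>R norm (centered a)"

text \<open>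
  The index types carry a well-order, as elsewhere in HOL-Analysis; on a finite type this is the
  same as a linear order. The tuples \<open>j\<^sub>1 < \<dots> < j\<^sub>m\<close> of column indices are then
  exactly the strictly monotone functions from \<open>'m\<close> to \<open>'n\<close>.
\<close>

definition column_submatrix ::
  "('m \<Rightarrow> real^'n) \<Rightarrow> ('m \<Rightarrow> 'n) \<Rightarrow> real^'m^'m" where
  "column_submatrix v j = (\<chi> i k. v i $ j k)"

definition incorrelation ::
  "('m::{finite,wellorder} \<Rightarrow> real^'n::{finite,wellorder}) \<Rightarrow> real" where
  "incorrelation a =
     sqrt (\<Sum>j | strict_mono j. (det (column_submatrix (\<lambda>i. standardized (a i)) j))\<^sup>2)"

definition parallelotope :: "('m::finite \<Rightarrow> 'a::real_vector) \<Rightarrow> 'a set" where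
  "parallelotope v = {\<Sum>i\<in>UNIV. t i *\<^sub>R v i | t. \<forall>i. 0 \<le> t i \<and> t i \<le> 1}"

definition linear_isometry :: "('a::real_normed_vector \<Rightarrow> 'b::real_normed_vector) \<Rightarrow> bool" where
  "linear_isometry f \<longleftrightarrow> linear f \<and> (\<forall>x. norm (f x) = norm x)"

text \<open>
  The \<open>m\<close>-dimensional Lebesgue measure on an \<open>m\<close>-dimensional subspace \<open>V\<close> of \<open>\<real>\<^sup>n\<close> is the
  Lebesgue measure of \<open>\<real>\<^sup>m\<close> transported along a linear isometry from \<open>\<real>\<^sup>m\<close> onto \<open>V\<close>. The
  dimension \<open>m\<close> is passed as an index type. The lemmas below show that, for a set of dimension
  at most \<open>m \<le> n\<close>, a suitable isometry exists, and that the choice of the isometry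
  and of the subspace (its range) does not matter.
\<close>

definition subspace_volume :: "'m::{finite,wellorder} itself \<Rightarrow> (real^'n) set \<Rightarrow> real" where
  "subspace_volume _ S =
     measure lebesgue ((SOME f :: real^'m::_ \<Rightarrow> real^'n. linear_isometry f \<and> S \<subseteq> range f) -` S)"

lemma linear_isometry_inj: "linear_isometry f \<Longrightarrow> inj f"
  unfolding linear_isometry_def
  by (metis linear_injective_0 norm_eq_zero)

lemma linear_isometry_covering_exists:
  fixes S :: "(real^'n) set"
  assumes "dim S \<le> CARD('m::finite)" and "CARD('m) \<le> CARD('n)"
  shows "\<exists>f :: real^'m \<Rightarrow> real^'n. linear_isometry f \<and> S \<subseteq> range f"
proof -
  obtain T where T: "subspace T" "span S \<subseteq> T" "dim T = CARD('m)"
  proof -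
    obtain B where B: "B \<subseteq> span S" "independent B" "span B = span S" "card B = dim S"
      by (metis basis_exists dim_span span_subspace subspace_span)
    obtain C where C: "B \<subseteq> C" "independent C" "span C = (UNIV :: (real^'n) set)"
      using maximal_independent_subset_extend[of B UNIV] B(2) by (metis subset_UNIV top.extremum_uniqueI)
    have finC: "finite C" and cC: "card C = CARD('n)"
      using C by (auto simp: independent_imp_finite dim_eq_card_independent[symmetric]
          intro: independent_imp_finite)
        (metis DIM_cart DIM_real dim_UNIV dim_eq_card_independent dim_span mult.right_neutral)
    obtain D where D: "B \<subseteq> D" "D \<subseteq> C" "card D = CARD('m)"
      using exists_subset_between[of B "CARD('m)" C] B(4) C(1) finC cC assms by auto
    show thesis
    proof
      show "subspace (span D)" by simp
      show "span S \<subseteq> span D" using B(3) D(1) span_mono by metis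
      show "dim (span D) = CARD('m)"
        using D C(2) by (metis dim_eq_card_independent dim_span independent_mono)
    qed
  qed
  have "dim (UNIV :: (real^'m) set) = dim T"
    using T(3) by simp
  then obtain f :: "real^'m \<Rightarrow> real^'n"
    where f: "linear f" "f ` UNIV = T" "\<And>x. x \<in> UNIV \<Longrightarrow> norm (f x) = norm x"
    using isometries_subspaces[OF subspace_UNIV T(1)] by metis
  then show ?thesis
    using T(2) span_superset unfolding linear_isometry_def by blast
qed

lemma measure_lebesgue_orthogonal_image:
  fixes h :: "real^'m::{finite,wellorder} \<Rightarrow> real^'m::_"
  assumes h: "orthogonal_transformation h"
  shows "measure lebesgue (h ` A) = measure lebesgue A"
proof -
  have zero: "measure lebesgue B = 0" if "B \<notin> lmeasurable" for B :: "(real^'m::_) set"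
  proof (cases "B \<in> sets lebesgue")
    case True
    then have "emeasure lebesgue B = \<infinity>"
      using that unfolding fmeasurable_def infinity_ennreal_def
      by (metis (mono_tags, lifting) mem_Collect_eq top.not_eq_extremum)
    then show ?thesis by (simp add: measure_def)
  next
    case False
    then show ?thesis by (simp add: measure_notin_sets)
  qed
  have "A \<in> lmeasurable" if "h ` A \<in> lmeasurable"
    using measurable_orthogonal_image[OF orthogonal_transformation_inv[OF h] that]
      orthogonal_transformation_inj[OF h] by simp
  then show ?thesis
    using measure_orthogonal_image[OF h] zero by metis
qed

lemma linear_isometry_measure_unique:
  fixes f g :: "real^'m::{finite,wellorder} \<Rightarrow> real^'n"
  assumes f: "linear_isometry f" and g: "linear_isometry g"
    and S: "S \<subseteq> range f" "S \<subseteq> range g"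
  shows "measure lebesgue (f -` S) = measure lebesgue (g -` S)"
proof (cases "dim S < CARD('m)")
  case True
  have "measure lebesgue (k -` S) = 0"
    if k: "linear_isometry k" and kS: "S \<subseteq> range k" for k :: "real^'m::_ \<Rightarrow> real^'n"
  proof -
    have "dim (k ` (k -` S)) = dim (k -` S)"
      using k linear_isometry_inj[OF k]
      by (intro dim_image_eq) (auto simp: linear_isometry_def intro: inj_on_subset)
    moreover have "k ` (k -` S) = S" using kS by auto
    ultimately have "dim (k -` S) < DIM((real, 'm) vec)" using True by simp
    then show ?thesis
      using negligible_lowdim negligible_imp_measure0 by blast
  qed
  then show ?thesis using f g S by metis
next
  case False
  have full: "range k = span S"
    if k: "linear_isometry k" and kS: "S \<subseteq> range k" for k :: "real^'m::_ \<Rightarrow> real^'n"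
  proof -
    have lin: "linear k" using k by (simp add: linear_isometry_def)
    have "span S \<subseteq> range k"
      using kS by (simp add: lin linear_subspace_image span_minimal)
    moreover have "dim (range k) \<le> dim (span S)"
      using dim_image_le[OF lin, of UNIV] False by simp
    ultimately show ?thesis
      by (metis lin linear_subspace_image subspace_UNIV subspace_dim_equal subspace_span)
  qed
  have lin: "linear f" "linear g" using f g by (auto simp: linear_isometry_def)
  obtain f' where f': "linear f'" "f' \<circ> f = id"
    using linear_injective_left_inverse[OF lin(1) linear_isometry_inj[OF f]] by blast
  define h where "h = f' \<circ> g"
  have fh: "f (h x) = g x" for x
  proof -
    have "g x \<in> range f" using full f g S by blast
    then obtain y where "g x = f y" by blast
    then show ?thesis using f'(2) by (simp add: h_def) (metis comp_apply id_apply)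
  qed
  have h: "orthogonal_transformation h"
    unfolding orthogonal_transformation
  proof
    show "linear h" unfolding h_def by (rule linear_compose[OF lin(2) f'(1)])
    show "\<forall>v. norm (h v) = norm v" using f g fh unfolding linear_isometry_def by metis
  qed
  have "f -` S = h ` (g -` S)"
  proof
    show "h ` (g -` S) \<subseteq> f -` S" using fh by auto
    show "f -` S \<subseteq> h ` (g -` S)"
    proof
      fix x assume x: "x \<in> f -` S"
      obtain y where "x = h y" using orthogonal_transformation_surj[OF h] by (metis surjD)
      then show "x \<in> h ` (g -` S)" using x fh by auto
    qed
  qed
  then show ?thesis using measure_lebesgue_orthogonal_image[OF h] by simp
qed

lemma subspace_volume_eq:
  fixes f :: "real^'m::{finite,wellorder} \<Rightarrow> real^'n"
  assumes "linear_isometry f" and "S \<subseteq> range f"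
  shows "subspace_volume TYPE('m) S = measure lebesgue (f -` S)"
proof -
  let ?P = "\<lambda>f :: real^'m::_ \<Rightarrow> real^'n. linear_isometry f \<and> S \<subseteq> range f"
  have "?P (Eps ?P)" by (rule someI[of ?P f]) (use assms in blast)
  then show ?thesis
    unfolding subspace_volume_def using assms by (intro linear_isometry_measure_unique) auto
qed

end

theory Submission imports Defs begin

text \<open>
  Both sides equal the square root of the Gram determinant of the standardized vectors.
  For the volume, pull the vectors back along an isometry, which preserves inner products, to the
  rows of a square matrix \<open>W\<close>; the volume is \<open>\<bar>det W\<bar>\<close> and \<open>W W\<^sup>T\<close> is the Gram matrix.
  For the incorrelation coefficient this is the Cauchy--Binet formula: expand the Gram determinant
  over all maps \<open>j\<close> from rows to columns; non-injective maps contribute \<open>0\<close>, and an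
  injective one factors uniquely as a permutation followed by a strictly monotone map.
\<close>

text \<open>By well-founded induction: if \<open>s\<close> and \<open>t\<close> agree below
  \<open>x\<close>, then \<open>t x\<close> is a value \<open>s z\<close> with \<open>z\<close> not
  below \<open>x\<close>, since \<open>t\<close> is injective; hence \<open>s x \<le> t x\<close>,
  and symmetrically.\<close>

lemma strict_mono_range_unique:
  fixes s t :: "'a::wellorder \<Rightarrow> 'b::linorder"
  assumes s: "strict_mono s" and t: "strict_mono t" and eq: "range s = range t"
  shows "s = t"
proof
  have le: "f x \<le> g x" if f: "strict_mono f" and g: "strict_mono g" and r: "range f = range g"
    and IH: "\<And>y. y < x \<Longrightarrow> f y = g y" for f g :: "'a \<Rightarrow> 'b" and x
  proof -
    obtain z where z: "g x = f z" using r by (metis rangeE rangeI)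
    have "x \<le> z"
    proof (rule ccontr)
      assume "\<not> x \<le> z"
      then have "z < x" by simp
      then have "g z = g x" using IH z by simp
      then show False using strict_monoD[OF g \<open>z < x\<close>] by simp
    qed
    then show ?thesis using f z by (metis strict_mono_less_eq)
  qed
  show "s x = t x" for x
  proof (induction x rule: less_induct)
    case (less x)
    show ?case
      using le[OF s t eq less] le[OF t s eq[symmetric] less[symmetric]] by (rule order_antisym)
  qed
qed

lemma strict_mono_with_range_exists:
  fixes j :: "'m::{finite,linorder} \<Rightarrow> 'n::linorder"
  assumes "inj j"
  shows "\<exists>s::'m \<Rightarrow> 'n. strict_mono s \<and> range s = range j"
proof -
  define L where "L = sorted_list_of_set (range j)"
  \<comment> \<open>The zero-based rank of \<open>x\<close> in its type, used as the index into the
    sorted list of values of \<open>j\<close>.\<close>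
  define r where "r x = card {..<x}" for x :: 'm
  have r: "strict_mono r"
    unfolding r_def by (intro strict_monoI psubset_card_mono) auto
  have r_less: "r x < CARD('m)" for x
    unfolding r_def by (intro psubset_card_mono) auto
  have L: "set L = range j" "length L = CARD('m)" "sorted_wrt (<) L"
    using assms by (simp_all add: L_def card_image)
  define s where "s x = L ! r x" for x
  have s: "strict_mono s"
  proof (rule strict_monoI)
    fix x y :: 'm assume "x < y"
    then have "r x < r y" by (rule strict_monoD[OF r])
    then show "s x < s y"
      unfolding s_def using L r_less by (intro sorted_wrt_nth_less[of "(<)"]) simp_all
  qed
  \<comment> \<open>One inclusion suffices: both ranges are finite of the same size, as
    \<open>s\<close> and \<open>j\<close> are injective.\<close>
  have "range s \<subseteq> range j"
    unfolding s_def L(1)[symmetric] using r_less L(2) by (auto intro!: nth_mem)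
  moreover have "card (range s) = card (range j)"
    using assms s by (simp add: card_image strict_mono_imp_inj_on)
  ultimately show ?thesis using s by (metis card_subset_eq finite finite_imageI)
qed

text \<open>The range of \<open>j\<close> determines \<open>s\<close>, and injectivity of
  \<open>s\<close> then determines \<open>p\<close>. This reindexes the sum over injective column
  choices in Cauchy--Binet.\<close>

lemma bij_betw_strict_mono_permutes:
  "bij_betw (\<lambda>(s, p). s \<circ> p)
     ({s :: 'm::{finite,wellorder} \<Rightarrow> 'n::linorder. strict_mono s} \<times> {p. p permutes UNIV}) {j. inj j}"
  (is "bij_betw ?c ?A ?B")
proof (rule bij_betw_imageI)
  show "inj_on ?c ?A"
  proof (rule inj_onI, clarsimp)
    fix s t :: "'m \<Rightarrow> 'n" and p q
    assume s: "strict_mono s" and t: "strict_mono t" and p: "p permutes UNIV" and q: "q permutes UNIV"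
      and eq: "s \<circ> p = t \<circ> q"
    have "range s = range (s \<circ> p)" "range t = range (t \<circ> q)"
      using permutes_surj[OF p] permutes_surj[OF q] by (metis image_comp)+
    then have "s = t" using strict_mono_range_unique[OF s t] eq by simp
    moreover have "p x = q x" for x
      using fun_cong[OF eq, of x] strict_mono_eq[OF s] \<open>s = t\<close> by simp
    ultimately show "s = t \<and> p = q" by blast
  qed
  show "?c ` ?A = ?B"
  proof (intro equalityI subsetI)
    fix j assume "j \<in> ?c ` ?A"
    then show "j \<in> ?B"
      by (auto intro!: inj_compose simp: strict_mono_imp_inj_on permutes_inj)
  next
    fix j :: "'m \<Rightarrow> 'n" assume "j \<in> ?B"
    then have j: "inj j" by simp
    then obtain s :: "'m \<Rightarrow> 'n" where s: "strict_mono s" "range s = range j"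
      using strict_mono_with_range_exists by blast
    \<comment> \<open>\<open>inv s\<close> is meaningful only on the range of \<open>s\<close>,
      which contains every value of \<open>j\<close>.\<close>
    have sj: "s (inv s (j x)) = j x" for x
      using s(2) by (simp add: f_inv_into_f)
    have "inj (inv s \<circ> j)"
    proof (rule injI)
      fix x y assume "(inv s \<circ> j) x = (inv s \<circ> j) y"
      then have "s (inv s (j x)) = s (inv s (j y))" by (simp only: comp_apply)
      then show "x = y" unfolding sj by (rule injD[OF j])
    qed
    then have "bij (inv s \<circ> j)"
      by (intro bijI finite_UNIV_inj_surj) simp_all
    then have "(inv s \<circ> j) permutes UNIV"
      by (intro bij_imp_permutes) simp_all
    moreover have "s \<circ> (inv s \<circ> j) = j" using sj by auto
    ultimately show "j \<in> ?c ` ?A"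
      using s(1) by (intro image_eqI[of _ _ "(s, inv s \<circ> j)"]) auto
  qed
qed

text \<open>Cauchy--Binet for the matrix with rows \<open>v i\<close> and its transpose: the two
  minors on the same columns are equal, hence the squares.\<close>

lemma det_Gram_eq_sum_column_submatrix:
  fixes v :: "'m::{finite,wellorder} \<Rightarrow> real^'n::{finite,wellorder}"
  shows "det (\<chi> i k. v i \<bullet> v k :: real^'m::_^'m::_)
    = (\<Sum>j | strict_mono j. (det (column_submatrix v j))\<^sup>2)"
proof -
  \<comment> \<open>Row \<open>i\<close> of the Gram matrix is the combination of the columns
    \<open>c p\<close> with coefficients \<open>v i $ p\<close>. Thus \<open>D j\<close> is the term
    of the multilinear expansion that picks column \<open>j i\<close> in row
    \<open>i\<close>.\<close>
  define c where "c p = (\<chi> k. v k $ p)" for p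
  define D where "D j = (\<Prod>i\<in>UNIV. v i $ j i) * det (\<chi> i. c (j i) :: real^'m::_^'m::_)" for j
  have "det (\<chi> i k. v i \<bullet> v k :: real^'m::_^'m::_)
      = (\<Sum>q | q permutes UNIV. of_int (sign q) * (\<Prod>i\<in>UNIV. \<Sum>p\<in>UNIV. v i $ p * c p $ q i))"
    by (simp add: det_def inner_vec_def c_def)
  also have "\<dots> = (\<Sum>q | q permutes UNIV. of_int (sign q) *
      (\<Sum>j\<in>UNIV. \<Prod>i\<in>UNIV. v i $ j i * c (j i) $ q i))"
    by (simp add: prod_sum_PiE PiE_UNIV_domain)
  also have "\<dots> = (\<Sum>j\<in>UNIV. \<Sum>q | q permutes UNIV. of_int (sign q) *
      (\<Prod>i\<in>UNIV. v i $ j i * c (j i) $ q i))"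
    unfolding sum_distrib_left by (rule sum.swap)
  also have "\<dots> = (\<Sum>j\<in>UNIV. D j)"
    by (simp add: D_def det_def prod.distrib sum_distrib_left mult.left_commute)
  also have "\<dots> = (\<Sum>j | inj j. D j)"
  proof (rule sum.mono_neutral_right)
    show "\<forall>j\<in>UNIV - {j. inj j}. D j = 0"
    proof
      fix j :: "'m \<Rightarrow> 'n" assume "j \<in> UNIV - {j. inj j}"
      then obtain x y where "x \<noteq> y" "j x = j y" by (auto simp: inj_def)
      then have "det (\<chi> i. c (j i) :: real^'m::_^'m::_) = 0"
        by (intro det_identical_rows[of x y]) (simp_all add: row_def)
      then show "D j = 0" by (simp add: D_def)
    qed
  qed auto
  also have "\<dots> = (\<Sum>(s, p)\<in>{s. strict_mono s} \<times> {p. p permutes UNIV}. D (s \<circ> p))"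
    by (subst sum.reindex_bij_betw[OF bij_betw_strict_mono_permutes, symmetric])
      (simp add: case_prod_unfold)
  also have "\<dots> = (\<Sum>s | strict_mono s. \<Sum>p | p permutes UNIV. D (s \<circ> p))"
    by (rule sum.cartesian_product[symmetric])
  also have "\<dots> = (\<Sum>s | strict_mono s. (det (column_submatrix v s))\<^sup>2)"
  proof (rule sum.cong[OF refl])
    fix s :: "'m \<Rightarrow> 'n"
    have "det (\<chi> i. c (s i) :: real^'m::_^'m::_) = det (transpose (column_submatrix v s))"
      by (intro arg_cong[of _ _ det])
        (simp add: vec_eq_iff transpose_def column_submatrix_def c_def)
    then have cs: "det (\<chi> i. c (s i) :: real^'m::_^'m::_) = det (column_submatrix v s)"
      by simp
    \<comment> \<open>Undoing the row permutation \<open>p\<close> yields its sign. With the product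
      of entries this is a Leibniz term of the minor, so summing over \<open>p\<close> produces the
      second factor of the square.\<close>
    have "D (s \<circ> p) = of_int (sign p) * (\<Prod>i\<in>UNIV. column_submatrix v s $ i $ p i)
        * det (column_submatrix v s)" if "p permutes UNIV" for p
      using det_permute_rows[OF that, of "\<chi> i. c (s i)"] cs
      by (simp add: D_def column_submatrix_def)
    then show "(\<Sum>p | p permutes UNIV. D (s \<circ> p)) = (det (column_submatrix v s))\<^sup>2"
      by (simp add: power2_eq_square det_def flip: sum_distrib_right)
  qed
  finally show ?thesis .
qed

text \<open>A linear image of the unit cube has volume the absolute determinant of the map. The map
  has the \<open>w i\<close> as columns, whence the transpose in \<open>A\<close>.\<close>

lemma measure_parallelotope:
  fixes w :: "'m::{finite,wellorder} \<Rightarrow> real^'m::_"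
  shows "measure lebesgue (parallelotope w) = \<bar>det (\<chi> i. w i)\<bar>"
proof -
  define A where "A = transpose (\<chi> i. w i)"
  have A: "A *v x = (\<Sum>i\<in>UNIV. x $ i *\<^sub>R w i)" for x
    by (simp add: A_def matrix_mult_sum column_def transpose_def scalar_mult_eq_scaleR vec_eq_iff)
  have "parallelotope w = (*v) A ` cbox 0 1"
  proof (intro equalityI subsetI)
    fix y assume "y \<in> parallelotope w"
    then obtain t where t: "y = (\<Sum>i\<in>UNIV. t i *\<^sub>R w i)" "\<forall>i. 0 \<le> t i \<and> t i \<le> 1"
      by (auto simp: parallelotope_def)
    then show "y \<in> (*v) A ` cbox 0 1"
      by (intro image_eqI[of _ _ "\<chi> i. t i"]) (auto simp: A mem_box_cart)
  next
    fix y assume "y \<in> (*v) A ` cbox 0 1"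
    then show "y \<in> parallelotope w"
      by (auto simp: A mem_box_cart parallelotope_def)
  qed
  moreover have "measure lebesgue (cbox 0 (1::real^'m::_)) = 1"
    by (simp add: content_cbox_cart interval_ne_empty_cart)
  ultimately show ?thesis
    using measure_linear_image[of "(*v) A" "cbox 0 1"] by (simp add: A_def)
qed

lemma parallelotope_linear_image:
  assumes "linear f"
  shows "parallelotope (\<lambda>i. f (w i)) = f ` parallelotope w"
proof -
  have "(\<Sum>i\<in>UNIV. t i *\<^sub>R f (w i)) = f (\<Sum>i\<in>UNIV. t i *\<^sub>R w i)" for t
    by (simp only: linear_sum[OF assms] linear_cmul[OF assms])
  then show ?thesis
    unfolding parallelotope_def by (simp only:) blast
qed

text \<open>By polarization, the inner product is a function of norms of \<open>x\<close>,
  \<open>y\<close> and \<open>x + y\<close>.\<close>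

lemma linear_isometry_inner:
  fixes f :: "'a::real_inner \<Rightarrow> 'b::real_inner"
  assumes "linear_isometry f"
  shows "f x \<bullet> f y = x \<bullet> y"
proof -
  have f: "linear f" "norm (f z) = norm z" for z
    using assms by (auto simp: linear_isometry_def)
  show ?thesis
    unfolding dot_norm linear_add[OF f(1), symmetric] f(2) ..
qed

lemma subspace_volume_parallelotope:
  fixes v :: "'m::{finite,wellorder} \<Rightarrow> real^'n"
  assumes "CARD('m) \<le> CARD('n)"
  shows "subspace_volume TYPE('m) (parallelotope v)
    = sqrt (det (\<chi> i k. v i \<bullet> v k :: real^'m::_^'m::_))"
proof -
  \<comment> \<open>An upper bound on the dimension is enough, so linearly dependent vectors need no
    separate case.\<close>
  have "dim (range v) \<le> CARD('m)"
    by (rule order_trans[OF dim_le_card' card_image_le]) simp_all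
  then obtain f :: "real^'m::_ \<Rightarrow> real^'n" where f: "linear_isometry f" "range v \<subseteq> range f"
    using linear_isometry_covering_exists[OF _ assms] by blast
  then have "\<forall>i. \<exists>x. v i = f x" by blast
  then obtain w where "\<forall>i. v i = f (w i)" by (rule choice[THEN exE])
  then have w: "v = (\<lambda>i. f (w i))" by (simp add: fun_eq_iff)
  have P: "parallelotope v = f ` parallelotope w"
    unfolding w using f(1) by (intro parallelotope_linear_image) (simp add: linear_isometry_def)
  let ?W = "(\<chi> i. w i) :: real^'m::_^'m::_"
  have "subspace_volume TYPE('m) (parallelotope v) = measure lebesgue (f -` parallelotope v)"
    using f P by (intro subspace_volume_eq) auto
  also have "f -` parallelotope v = parallelotope w"
    unfolding P by (simp add: inj_vimage_image_eq linear_isometry_inj[OF f(1)])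
  \<comment> \<open>The determinant on the right is the square of \<open>det ?W\<close>, and its
    root is the absolute value.\<close>
  also have "measure lebesgue (parallelotope w) = sqrt (det (?W ** transpose ?W))"
    by (simp add: measure_parallelotope det_mul)
  also have "?W ** transpose ?W = (\<chi> i k. v i \<bullet> v k)"
    by (simp add: w linear_isometry_inner[OF f(1)])
      (simp add: vec_eq_iff matrix_matrix_mult_def transpose_def inner_vec_def)
  finally show ?thesis .
qed

theorem corollary4:
  fixes a :: "'m::{finite,wellorder} \<Rightarrow> real^'n::{finite,wellorder}"
  assumes "2 \<le> CARD('m)" and "CARD('m) \<le> CARD('n)"
    and "\<And>i. nonzero_variance (a i)"
  shows "incorrelation a =
    subspace_volume TYPE('m) (parallelotope (\<lambda>i. standardized (a i)))"
  unfolding incorrelation_def subspace_volume_parallelotope[OF assms(2)]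
    det_Gram_eq_sum_column_submatrix ..

end
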